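(* Let $A=(A_{ij})$ and $B=(B_{ij})$ be $m\times n$ matrices with entries in $\mathbb{R}\cup\{-\infty\}$ such that for every $j\in[n]$ there exists $i\in[m]$ with $A_{ij}\neq-\infty$, and for every $i\in[m]$ there exists $j\in[n]$ with $B_{ij}\neq-\infty$. Consider $$P:=\Bigl\{x\in(\mathbb{R}\cup\{-\infty\})^n \;:\; \max_{j\in[n]}(A_{ij}+x_j)\leq\max_{j\in[n]}(B_{ij}+x_j)\ \ \forall i\in[m]\Bigr\}$$ and define the support $S$ of $P$ to be the union of the supports of the elements of $P$: $$S:=\{j\in[n] : \exists u\in P,\ u_j\neq-\infty\}.$$ Then $S$ is the support of an element of $P$, that is, there exists $u\in P$ such that $S=\{j\in[n]: u_j\neq-\infty\}$. Moreover, $S$ coincides with the set of initial states with a nonnegative value for the associated mean payoff game, that is, $$S=\{j\in[n]:\chi_j(f)\geq0\},$$ where $f:(\mathbb{R}\cup\{-\infty\})^n\to(\mathbb{R}\cup\{-\infty\})^n$ is given by $f_j(x)=\min_{i\in[m]}\bigl(-A_{ij}+\max_{k\in[n]}(B_{ik}+x_k)\bigr)$.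
   Context: Write $[n]=\{1,\dots,n\}$. In the definition of $f$, the convention is $(+\infty)+(-\infty)=+\infty$ (so indices $i$ with $A_{ij}=-\infty$ do not contribute to the minimum). Under the stated assumptions $f$ maps $\mathbb{R}^n$ to itself, and $\chi(f):=\lim_{N\to\infty}f^N(0)/N\in\mathbb{R}^n$ exists, where $f^N$ is the $N$-th iterate of $f$; $\chi_j(f)$ is its $j$-th coordinate. The map $f$ is the dynamic programming operator of the following mean payoff game: players Max and Min alternate moves on the disjoint union of $[m]$ and $[n]$; in state $j\in[n]$, Min chooses $i\in[m]$ with $A_{ij}\neq-\infty$, moves to $i$ and receives $A_{ij}$ from Max; in state $i\in[m]$, Max chooses $j\in[n]$ with $B_{ij}\neq-\infty$, moves to $j$ and receives $B_{ij}$ from Min. $f^N_j(0)$ is the value (for Max) of the $N$-turn game started at $j$, and $\chi_j(f)$ is the value of the mean payoff game with initial state $j$. *)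

theory Defs
  imports "HOL-Analysis.Analysis"
begin

text \<open>
  The semiring $R \cup \{-\infty\}$ is rendered by \<^typ>\<open>ereal\<close> with the value
  \<^term>\<open>\<infinity>\<close> excluded explicitly; an $m \times n$ matrix is an element of
  \<^typ>\<open>ereal ^ 'n ^ 'm\<close>.
\<close>

definition tropical_polyhedron :: "ereal ^ 'n ^ 'm \<Rightarrow> ereal ^ 'n ^ 'm \<Rightarrow> (ereal ^ 'n) set"
  where "tropical_polyhedron A B =
    {x. (\<forall>j. x $ j \<noteq> \<infinity>) \<and>
        (\<forall>i. (MAX j\<in>UNIV. A $ i $ j + x $ j) \<le> (MAX j\<in>UNIV. B $ i $ j + x $ j))}"

definition vec_support :: "ereal ^ 'n \<Rightarrow> 'n set"
  where "vec_support u = {j. u $ j \<noteq> -\<infinity>}"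

definition polyhedron_support :: "ereal ^ 'n ^ 'm \<Rightarrow> ereal ^ 'n ^ 'm \<Rightarrow> 'n set"
  where "polyhedron_support A B = (\<Union>u \<in> tropical_polyhedron A B. vec_support u)"

text \<open>
  Addition on \<^typ>\<open>ereal\<close> satisfies $(+\infty) + (-\infty) = +\infty$, so indices \<open>i\<close> with
  \<open>A $ i $ j = -\<infinity>\<close> do not contribute to the minimum.
\<close>

definition dp_operator :: "ereal ^ 'n ^ 'm \<Rightarrow> ereal ^ 'n ^ 'm \<Rightarrow> ereal ^ 'n \<Rightarrow> ereal ^ 'n"
  where "dp_operator A B x =
    (\<chi> j. MIN i\<in>UNIV. - (A $ i $ j) + (MAX k\<in>UNIV. B $ i $ k + x $ k))"

text \<open>
  The conversion \<^const>\<open>real_of_ereal\<close> is harmless for operators that preserve finiteness of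
  all coordinates; see \<open>dp_operator_funpow_finite\<close> below.
\<close>

definition mean_payoff :: "(ereal ^ 'n \<Rightarrow> ereal ^ 'n) \<Rightarrow> real ^ 'n"
  where "mean_payoff f = lim (\<lambda>N. \<chi> j. real_of_ereal ((f ^^ N) 0 $ j) / real N)"

lemma dp_operator_finite:
  fixes A B :: "ereal ^ 'n ^ 'm"
  assumes "\<And>i j. A $ i $ j \<noteq> \<infinity>" and "\<And>i j. B $ i $ j \<noteq> \<infinity>"
    and "\<And>j. \<exists>i. A $ i $ j \<noteq> -\<infinity>" and "\<And>i. \<exists>j. B $ i $ j \<noteq> -\<infinity>"
    and x: "\<And>j. \<bar>x $ j\<bar> \<noteq> \<infinity>"
  shows "\<bar>dp_operator A B x $ j\<bar> \<noteq> \<infinity>"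
proof -
  define M where "M i = (MAX k\<in>UNIV. B $ i $ k + x $ k)" for i
  have M: "\<bar>M i\<bar> \<noteq> \<infinity>" for i
  proof -
    have "M i \<in> range (\<lambda>k. B $ i $ k + x $ k)"
      unfolding M_def by (rule Max_in) auto
    then have "M i \<noteq> \<infinity>"
      using assms(2) x by (metis (no_types, lifting) abs_ereal.simps(3) imageE plus_ereal.simps(1) ereal_plus_eq_PInfty)
    moreover obtain k where k: "B $ i $ k \<noteq> -\<infinity>"
      using assms(4) by blast
    have "B $ i $ k + x $ k \<le> M i"
      unfolding M_def by (rule Max_ge) auto
    with k x[of k] have "M i \<noteq> -\<infinity>"
      by (cases "B $ i $ k"; cases "x $ k") auto
    ultimately show ?thesis by auto
  qed
  define v where "v = (MIN i\<in>UNIV. - (A $ i $ j) + M i)"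
  have "v \<in> range (\<lambda>i. - (A $ i $ j) + M i)"
    unfolding v_def by (rule Min_in) auto
  then obtain i where i: "v = - (A $ i $ j) + M i" by blast
  have "v \<noteq> -\<infinity>"
    using i assms(1)[of i j] M[of i] by (cases "A $ i $ j"; cases "M i") auto
  moreover obtain i' where i': "A $ i' $ j \<noteq> -\<infinity>"
    using assms(3) by blast
  have "v \<le> - (A $ i' $ j) + M i'"
    unfolding v_def by (rule Min_le) auto
  then have "v \<noteq> \<infinity>"
    using i' assms(1)[of i' j] M[of i'] by (cases "A $ i' $ j"; cases "M i'") auto
  ultimately have "\<bar>v\<bar> \<noteq> \<infinity>" by (cases v) auto
  then show ?thesis
    by (simp add: dp_operator_def v_def M_def)
qed

lemma dp_operator_funpow_finite:
  fixes A B :: "ereal ^ 'n ^ 'm"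
  assumes "\<And>i j. A $ i $ j \<noteq> \<infinity>" and "\<And>i j. B $ i $ j \<noteq> \<infinity>"
    and "\<And>j. \<exists>i. A $ i $ j \<noteq> -\<infinity>" and "\<And>i. \<exists>j. B $ i $ j \<noteq> -\<infinity>"
  shows "\<bar>(dp_operator A B ^^ N) 0 $ j\<bar> \<noteq> \<infinity>"
proof (induction N arbitrary: j)
  case 0
  show ?case by simp
next
  case (Suc N)
  show ?case
    unfolding funpow.simps o_def by (rule dp_operator_finite[OF assms Suc.IH])
qed

end

theory Submission
  imports Defs
begin

text \<open>
  A vector \<open>x\<close> without entries $+\infty$ lies in $P$ iff \<open>x \<le> f x\<close>, where \<open>f\<close> is the dynamic
  programming operator. The theorem is read off from an \<^emph>\<open>invariant half-line\<close> of \<open>f\<close>: real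
  vectors \<open>w\<close> and \<open>\<eta>\<close> such that \<open>f (w + t \<eta>) = w + (t + 1) \<eta>\<close> for all large \<open>t\<close>.

  Iterating along the half-line and using that \<open>f\<close> is nonexpansive for the maximum norm gives
  \<open>f\<^sup>N v / N \<longlonglongrightarrow> \<eta>\<close> for every real vector \<open>v\<close> (\<open>escape_rate\<close>). So the mean payoff exists and
  equals \<open>\<eta>\<close>. If \<open>x \<in> P\<close>, then \<open>x \<le> f\<^sup>N x \<le> f\<^sup>N v\<close> for every real \<open>v \<ge> x\<close>, which forces
  \<open>\<eta>\<^sub>j \<ge> 0\<close> wherever \<open>x\<^sub>j\<close> is finite (\<open>support_imp_nonneg_rate\<close>). Conversely, replace the entries of
  \<open>w + t \<eta>\<close> with \<open>\<eta>\<^sub>j < 0\<close> by $-\infty$. For large \<open>t\<close>, the inequality \<open>w + (t + 1) \<eta> \<le> f (w + t \<eta>)\<close> at \<open>j\<close>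
  holds because, against each move of Min, Max can reach a coordinate \<open>k\<close> with
  \<open>\<eta>\<^sub>k \<ge> \<eta>\<^sub>j\<close>, which is kept if \<open>j\<close> is; so the truncated vector still satisfies
  \<open>u \<le> f u\<close>; its support is \<open>{j. \<eta>\<^sub>j \<ge> 0}\<close> (\<open>nonneg_rates_are_support\<close>). The two inclusions together
  give both claims.

  The half-line is Kohlberg's theorem, obtained here by letting a discount factor tend to \<open>1\<close>
  (\<open>invariant_half_line\<close>). Let \<open>x\<^sub>n\<close> be a fixed point of \<open>x \<mapsto> f (\<alpha>\<^sub>n x)\<close> with
  \<open>\<alpha>\<^sub>n = 1 - 1/T\<^sub>n\<close> and \<open>T\<^sub>n \<longlonglongrightarrow> \<infinity>\<close>. Each coordinate of \<open>f x\<close> is one of finitely many translates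
  \<open>c + x\<^sub>k\<close>, so for infinitely many \<open>n\<close> the same choices are made and \<open>x\<^sub>n\<close> solves a fixed system
  \<open>x j = c j + \<alpha>\<^sub>n x (p j)\<close>. The average \<open>\<eta>\<close> of \<open>c\<close> over the cycles of \<open>p\<close> then makes
  \<open>x\<^sub>n - T\<^sub>n \<eta>\<close> bounded; let \<open>w\<close> be a limit point. Now \<open>\<alpha>\<^sub>n x\<^sub>n = w + (T\<^sub>n - 1) \<eta> + o(1)\<close>, hence
  \<open>f (w + (T\<^sub>n - 1) \<eta>) = w + T\<^sub>n \<eta> + o(1)\<close>. Since \<open>f\<close> is eventually affine along a ray, the error
  term vanishes for all large arguments.
\<close>

section \<open>The Poisson equation on a functional graph\<close>

lemma funpow_eventually_periodic:
  fixes p :: "'n::finite \<Rightarrow> 'n"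
  obtains q K where "K > 0" "\<And>j. (p ^^ (q + K)) j = (p ^^ q) j"
proof -
  have "\<not> inj (\<lambda>N. p ^^ N)"
    using finite_imageD[of "\<lambda>N. p ^^ N" UNIV] by (metis finite finite_code infinite_UNIV_nat)
  then obtain M N where "M \<noteq> N" and eq: "p ^^ M = p ^^ N"
    by (auto simp: inj_def)
  then obtain q K where "K > 0" "p ^^ (q + K) = p ^^ q"
  proof (cases "M < N")
    case True
    then show ?thesis using that[of "N - M" M] eq by simp
  next
    case False
    then show ?thesis using that[of "M - N" N] eq \<open>M \<noteq> N\<close> by simp
  qed
  then show thesis using that by metis
qed

text \<open>
  The constant \<open>\<eta> j\<close> is the mean of \<open>c\<close> over the cycle that the orbit of \<open>j\<close> runs into. With
  \<open>s N\<close> the partial sums of \<open>c - \<eta>\<close> along the orbit, \<open>s (N + 1) j = (c - \<eta>) j + s N (p j)\<close>, and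
  \<open>s\<close> is periodic in \<open>N\<close> once the orbit is on its cycle. Hence the average of \<open>s N\<close> over one period
  does not change when \<open>N\<close> is shifted by one, and it solves the equation.
\<close>
lemma poisson_equation_functional_graph:
  fixes p :: "'n::finite \<Rightarrow> 'n" and c :: "'n \<Rightarrow> real"
  obtains \<eta> u where "\<And>j. \<eta> (p j) = \<eta> j" "\<And>j. u j + \<eta> j = c j + u (p j)"
proof -
  obtain q K where K: "K > 0" and per: "\<And>j. (p ^^ (q + K)) j = (p ^^ q) j"
    by (rule funpow_eventually_periodic[of p]) (rule that)
  have shift: "(\<Sum>l = q..<q+K. h (Suc l)) = (\<Sum>l = q..<q+K. h l)"
    if "h (q + K) = h q" for h :: "nat \<Rightarrow> real"
  proof -
    have "(\<Sum>l = q..<q+K. h (Suc l)) - (\<Sum>l = q..<q+K. h l) = h (q + K) - h q"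
      unfolding sum_subtractf[symmetric] by (rule sum_Suc_diff') simp
    with that show ?thesis by simp
  qed
  define \<eta> where "\<eta> j = (\<Sum>l = q..<q+K. c ((p ^^ l) j)) / K" for j
  define g where "g j = c j - \<eta> j" for j
  define s where "s N j = (\<Sum>l<N. g ((p ^^ l) j))" for N j
  define u where "u j = (\<Sum>N = q..<q+K. s N j) / K" for j
  have \<eta>p: "\<eta> (p j) = \<eta> j" for j
    using shift[of "\<lambda>l. c ((p ^^ l) j)"] per by (simp add: \<eta>_def funpow_Suc_right del: funpow.simps)
  have \<eta>pl: "\<eta> ((p ^^ l) j) = \<eta> j" for l j
    by (induction l) (simp_all add: \<eta>p)
  have sSuc: "s (Suc N) j = g j + s N (p j)" for N j
    unfolding s_def by (subst sum.lessThan_Suc_shift) (simp add: funpow_Suc_right del: funpow.simps)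
  have "s (q + K) j - s q j = (\<Sum>l = q..<q+K. g ((p ^^ l) j))" for j
    unfolding s_def by (simp add: lessThan_atLeast0 sum_diff_nat_ivl)
  also have "\<dots> j = 0" for j
    using K by (simp add: g_def sum_subtractf \<eta>pl) (simp add: \<eta>_def)
  finally have sper: "s (q + K) j = s q j" for j by simp
  have "u j + \<eta> j = c j + u (p j)" for j
  proof -
    have "u j = (\<Sum>N = q..<q+K. s (Suc N) j) / K"
      using shift[of "\<lambda>N. s N j"] sper by (simp add: u_def)
    also have "\<dots> = g j + u (p j)"
      using K by (simp add: sSuc sum.distrib u_def add_divide_distrib)
    finally show ?thesis by (simp add: g_def)
  qed
  with \<eta>p show thesis by (rule that)
qed

section \<open>Invariant half-lines\<close>

text \<open>
  The existence of invariant half-lines uses nothing of the min-max form of the operator beyond these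
  properties. The first combines monotonicity and subhomogeneity under adding constants.
\<close>
locale choice_operator =
  fixes F :: "('n::finite \<Rightarrow> real) \<Rightarrow> 'n \<Rightarrow> real" and C :: "(real \<times> 'n) set"
  assumes shift_mono: "(\<And>k. x k \<le> y k + d) \<Longrightarrow> F x j \<le> F y j + d"
    and finite_choices: "finite C"
    and choice: "\<exists>(c, k) \<in> C. F x j = c + x k"
    and eventually_affine: "\<exists>c k. \<forall>\<^sub>F t in at_top. F (\<lambda>l. w l + t * \<eta> l) j = c + t * \<eta> k"
begin

lemma nonexpansive:
  assumes "\<And>k. \<bar>x k - y k\<bar> \<le> d"
  shows "\<bar>F x j - F y j\<bar> \<le> d"
proof -
  have "x k \<le> y k + d" "y k \<le> x k + d" for k
    using assms[of k] by linarith+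
  then have "F x j \<le> F y j + d" "F y j \<le> F x j + d"
    by (intro shift_mono; blast)+
  then show ?thesis by linarith
qed

lemma funpow_nonexpansive:
  assumes "\<And>k. \<bar>x k - y k\<bar> \<le> d"
  shows "\<bar>(F ^^ N) x j - (F ^^ N) y j\<bar> \<le> d"
proof (induction N arbitrary: j)
  case (Suc N)
  then show ?case by (simp add: nonexpansive)
qed (simp add: assms)

text \<open>
  The Knaster--Tarski argument: \<open>x \<mapsto> F (\<alpha> x)\<close> is monotone and maps the box \<open>[-M, M]\<close> to itself as soon
  as \<open>M\<close> satisfies \<open>M\<^sub>0 + \<alpha> M \<le> M\<close>, where \<open>M\<^sub>0\<close> bounds \<open>F 0\<close>.
\<close>
lemma discounted_fixed_point:
  assumes "0 \<le> \<alpha>" "\<alpha> < 1"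
  obtains x where "\<And>j. F (\<lambda>k. \<alpha> * x k) j = x j"
proof -
  define g where "g x = F (\<lambda>k. \<alpha> * x k)" for x
  define M\<^sub>0 where "M\<^sub>0 = (\<Sum>j\<in>UNIV. \<bar>F (\<lambda>_. 0) j\<bar>)"
  define M where "M = M\<^sub>0 / (1 - \<alpha>)"
  have M\<^sub>0: "\<bar>F (\<lambda>_. 0) j\<bar> \<le> M\<^sub>0" for j
    unfolding M\<^sub>0_def by (rule member_le_sum) auto
  have M: "M\<^sub>0 + \<alpha> * M = M"
    using assms by (simp add: M_def field_simps)
  have "0 \<le> M"
    using M\<^sub>0[of undefined] assms by (simp add: M_def)
  have box: "\<bar>g y j\<bar> \<le> M" if "\<And>k. \<bar>y k\<bar> \<le> M" for y j
  proof -
    have "\<bar>\<alpha> * y k - 0\<bar> \<le> \<alpha> * M" for k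
      using that[of k] assms by (simp add: abs_mult mult_left_mono)
    then have "\<bar>g y j - F (\<lambda>_. 0) j\<bar> \<le> \<alpha> * M"
      unfolding g_def by (rule nonexpansive)
    with M\<^sub>0[of j] M show ?thesis by linarith
  qed
  have mono: "g x j \<le> g y j" if "\<And>k. x k \<le> y k" for x y j
    using shift_mono[of "\<lambda>k. \<alpha> * x k" "\<lambda>k. \<alpha> * y k" 0 j] that assms
    by (simp add: g_def mult_left_mono)
  define Y where "Y = {y. (\<forall>k. \<bar>y k\<bar> \<le> M) \<and> (\<forall>k. y k \<le> g y k)}"
  define x where "x j = (SUP y\<in>Y. y j)" for j
  have bdd: "bdd_above ((\<lambda>y. y j) ` Y)" for j
    by (rule bdd_aboveI[of _ M]) (auto simp: Y_def abs_le_iff)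
  have "(\<lambda>_. - M) \<in> Y"
    using box[of "\<lambda>_. - M"] \<open>0 \<le> M\<close> by (auto simp: Y_def abs_le_iff minus_le_iff)
  then have "Y \<noteq> {}" by blast
  have upper: "y j \<le> x j" if "y \<in> Y" for y j
    unfolding x_def using bdd that by (rule cSUP_upper2) simp
  have x_le: "x j \<le> g x j" for j
    unfolding x_def[of j]
  proof (rule cSUP_least[OF \<open>Y \<noteq> {}\<close>])
    fix y assume y: "y \<in> Y"
    then have "y j \<le> g y j" by (simp add: Y_def)
    also have "\<dots> \<le> g x j" by (rule mono) (rule upper[OF y])
    finally show "y j \<le> g x j" .
  qed
  have "\<bar>x j\<bar> \<le> M" for j
  proof -
    have "x j \<le> M"
      unfolding x_def by (rule cSUP_least[OF \<open>Y \<noteq> {}\<close>]) (auto simp: Y_def abs_le_iff)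
    with upper[OF \<open>(\<lambda>_. - M) \<in> Y\<close>, of j] show ?thesis by simp
  qed
  then have "g x \<in> Y"
    using box mono x_le by (simp add: Y_def)
  then have "g x j \<le> x j" for j by (rule upper)
  with x_le have "g x j = x j" for j by (simp add: antisym)
  then show thesis by (intro that) (simp add: g_def)
qed

text \<open>
  Subtracting \<open>t \<eta> + u\<close> from the discounted equation leaves \<open>d j = \<alpha> d (p j) - (1 - \<alpha>) u (p j)\<close>. At an
  index where \<open>\<bar>d\<bar>\<close> is maximal this says \<open>(1 - \<alpha>) \<bar>d\<bar> \<le> (1 - \<alpha>) U\<close>, a bound that does not depend
  on the discount factor.
\<close>
lemma fixed_points_along_ray_bounded:
  fixes p :: "'n \<Rightarrow> 'n" and u :: "'n \<Rightarrow> real"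
  assumes \<alpha>: "0 < t" "\<alpha> = 1 - 1 / t" "0 \<le> \<alpha>"
    and \<eta>: "\<And>j. \<eta> (p j) = \<eta> j" and u: "\<And>j. u j + \<eta> j = c j + u (p j)"
    and x: "\<And>j. x j = c j + \<alpha> * x (p j)"
  shows "\<bar>x j - t * \<eta> j\<bar> \<le> 2 * (\<Sum>k\<in>UNIV. \<bar>u k\<bar>)"
proof -
  define U where "U = (\<Sum>k\<in>UNIV. \<bar>u k\<bar>)"
  have U: "\<bar>u k\<bar> \<le> U" for k
    unfolding U_def by (rule member_le_sum) auto
  define d where "d j = x j - t * \<eta> j - u j" for j
  have d: "d j = \<alpha> * d (p j) - (1 - \<alpha>) * u (p j)" for j
  proof -
    have "\<alpha> * t = t - 1" using \<alpha> by (simp add: field_simps)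
    then have "\<alpha> * (t * \<eta> j) = t * \<eta> j - \<eta> j"
      by (metis (no_types) left_diff_distrib mult.assoc mult_1)
    then show ?thesis
      using x[of j] u[of j] \<eta>[of j] by (simp add: d_def algebra_simps)
  qed
  define D where "D = (MAX j. \<bar>d j\<bar>)"
  have D: "\<bar>d k\<bar> \<le> D" for k
    unfolding D_def by (rule Max_ge) auto
  have "D \<in> range (\<lambda>j. \<bar>d j\<bar>)"
    unfolding D_def by (rule Max_in) auto
  then obtain l where l: "D = \<bar>d l\<bar>" by blast
  have "\<alpha> < 1" using \<alpha> by simp
  have "D \<le> \<bar>\<alpha> * d (p l)\<bar> + \<bar>(1 - \<alpha>) * u (p l)\<bar>"
    unfolding l d[of l] by (rule abs_triangle_ineq4)
  also have "\<dots> \<le> \<alpha> * D + (1 - \<alpha>) * U"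
    using \<alpha>(3) \<open>\<alpha> < 1\<close> D U by (intro add_mono) (simp_all add: abs_mult mult_left_mono)
  finally have "(1 - \<alpha>) * D \<le> (1 - \<alpha>) * U" by (simp add: algebra_simps)
  then have "D \<le> U" using \<open>\<alpha> < 1\<close> by simp
  with D[of j] U[of j] show ?thesis
    unfolding d_def U_def by linarith
qed

text \<open>
  Two extractions of subsequences: finitely many choice functions make the choices constant, so that
  a single \<open>\<eta>\<close> serves all indices; compactness then gives \<open>w\<close>.
\<close>
lemma discounted_asymptotics:
  obtains T :: "nat \<Rightarrow> real" and x :: "nat \<Rightarrow> 'n \<Rightarrow> real" and \<eta> w
  where "filterlim T at_top sequentially" "\<And>n. 0 < T n"
    "\<And>n j. F (\<lambda>k. (1 - 1 / T n) * x n k) j = x n j"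
    "\<And>j. (\<lambda>n. x n j - T n * \<eta> j) \<longlonglongrightarrow> w j"
proof -
  define T where "T n = real n + 2" for n
  have "\<exists>x. \<forall>j. F (\<lambda>k. (1 - 1 / T n) * x k) j = x j" for n
    by (rule discounted_fixed_point[of "1 - 1 / T n"]) (auto simp: T_def)
  then obtain x where fixed: "\<And>n j. F (\<lambda>k. (1 - 1 / T n) * x n k) j = x n j"
    by metis
  have "\<exists>s. \<forall>j. s j \<in> C \<and> x n j = fst (s j) + (1 - 1 / T n) * x n (snd (s j))" for n
  proof (intro choice_iff[THEN iffD1] allI)
    fix j
    show "\<exists>s. s \<in> C \<and> x n j = fst s + (1 - 1 / T n) * x n (snd s)"
      using choice[of "\<lambda>k. (1 - 1 / T n) * x n k" j] unfolding fixed by force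
  qed
  then obtain s where s: "\<And>n j. s n j \<in> C"
    and xs: "\<And>n j. x n j = fst (s n j) + (1 - 1 / T n) * x n (snd (s n j))"
    by metis
  have "range s \<subseteq> (\<Pi>\<^sub>E j\<in>UNIV. C)"
    using s by auto
  then have "finite (range s)"
    by (rule finite_subset) (intro finite_PiE finite_choices finite)
  \<comment> \<open>Some choice function \<open>s n\<^sub>0\<close> is used for infinitely many discount factors.\<close>
  then obtain n\<^sub>0 where "infinite {n. s n = s n\<^sub>0}"
    using pigeonhole_infinite[of UNIV s] by auto
  then obtain r\<^sub>1 :: "nat \<Rightarrow> nat" where r\<^sub>1: "strict_mono r\<^sub>1" "\<And>n. s (r\<^sub>1 n) = s n\<^sub>0"
    using infinite_enumerate by blast
  define c where "c j = fst (s n\<^sub>0 j)" for j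
  define p where "p j = snd (s n\<^sub>0 j)" for j
  obtain \<eta> u where \<eta>: "\<And>j. \<eta> (p j) = \<eta> j" and u: "\<And>j. u j + \<eta> j = c j + u (p j)"
    by (rule poisson_equation_functional_graph[of p c]) (rule that)
  define y where "y n = (\<chi> j. x (r\<^sub>1 n) j - T (r\<^sub>1 n) * \<eta> j)" for n
  have bound: "\<bar>y n $ j\<bar> \<le> 2 * (\<Sum>k\<in>UNIV. \<bar>u k\<bar>)" for n j
    unfolding y_def vec_lambda_beta
  proof (rule fixed_points_along_ray_bounded[where p = p and \<alpha> = "1 - 1 / T (r\<^sub>1 n)" and c = c])
    show "x (r\<^sub>1 n) j = c j + (1 - 1 / T (r\<^sub>1 n)) * x (r\<^sub>1 n) (p j)" for j
      using xs[of "r\<^sub>1 n" j] by (simp add: r\<^sub>1(2) c_def p_def)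
  qed (simp_all add: T_def \<eta> u)
  have "norm (y n) \<le> (\<Sum>j\<in>(UNIV::'n set). 2 * (\<Sum>k\<in>UNIV. \<bar>u k\<bar>))" for n
    using norm_le_l1_cart[of "y n"] sum_mono[of UNIV "\<lambda>j. \<bar>y n $ j\<bar>", OF bound] by linarith
  then have "bounded (range y)"
    unfolding bounded_iff by blast
  then obtain w r\<^sub>2 where r\<^sub>2: "strict_mono r\<^sub>2" "(y \<circ> r\<^sub>2) \<longlonglongrightarrow> w"
    using bounded_imp_convergent_subsequence by blast
  define r where "r = r\<^sub>1 \<circ> r\<^sub>2"
  have r: "strict_mono r"
    unfolding r_def using r\<^sub>1(1) r\<^sub>2(1) by (rule strict_mono_o)
  show thesis
  proof (rule that[of "\<lambda>n. T (r n)" "\<lambda>n. x (r n)" \<eta> "\<lambda>j. w $ j"])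
    show "filterlim (\<lambda>n. T (r n)) at_top sequentially"
    proof (rule filterlim_compose[OF _ filterlim_subseq[OF r]])
      show "filterlim T at_top sequentially"
        by (rule filterlim_at_top_mono[OF filterlim_real_sequentially]) (simp add: T_def)
    qed
    show "0 < T (r n)" for n by (simp add: T_def)
    show "F (\<lambda>k. (1 - 1 / T (r n)) * x (r n) k) j = x (r n) j" for n j by (rule fixed)
    show "(\<lambda>n. x (r n) j - T (r n) * \<eta> j) \<longlonglongrightarrow> w $ j" for j
      using tendsto_vec_nth[OF r\<^sub>2(2), of j] by (simp add: y_def r_def o_def)
  qed
qed

lemma affine_limit_unique:
  fixes T :: "nat \<Rightarrow> real"
  assumes T: "filterlim T at_top sequentially"
    and lim: "(\<lambda>n. a + T n * b) \<longlonglongrightarrow> l"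
  shows "b = 0 \<and> a = l"
proof -
  have inv: "(\<lambda>n. inverse (T n)) \<longlonglongrightarrow> 0"
    by (rule tendsto_inverse_0_at_top[OF T])
  have "(\<lambda>n. (a + T n * b) * inverse (T n) - a * inverse (T n)) \<longlonglongrightarrow> l * 0 - a * 0"
    by (intro tendsto_intros lim inv)
  moreover have "\<forall>\<^sub>F n in sequentially. (a + T n * b) * inverse (T n) - a * inverse (T n) = b"
    using filterlim_at_top_dense[THEN iffD1, OF T, rule_format, of 0]
    by eventually_elim (simp add: field_simps)
  ultimately have "(\<lambda>n. b) \<longlonglongrightarrow> 0"
    by (simp add: tendsto_cong)
  then have "b = 0" by (simp add: LIMSEQ_const_iff)
  with lim show ?thesis by (simp add: LIMSEQ_const_iff)
qed

text \<open>
  The affine function \<open>c + t \<eta>\<^sub>k\<close> that \<open>F\<close> follows along the ray has to agree with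
  \<open>w\<^sub>j + (t + 1) \<eta>\<^sub>j\<close> up to \<open>o(1)\<close> along the unbounded sequence \<open>T n - 1\<close>, so the two are equal.
\<close>
lemma invariant_half_line:
  obtains w \<eta> where "\<forall>\<^sub>F t in at_top. \<forall>j. F (\<lambda>k. w k + t * \<eta> k) j = w j + (t + 1) * \<eta> j"
proof -
  obtain T x \<eta> w where T: "filterlim T at_top sequentially" "\<And>n. 0 < T n"
    and fixed: "\<And>n j. F (\<lambda>k. (1 - 1 / T n) * x n k) j = x n j"
    and lim: "\<And>j. (\<lambda>n. x n j - T n * \<eta> j) \<longlonglongrightarrow> w j"
    by (rule discounted_asymptotics) (rule that)
  have inv: "(\<lambda>n. inverse (T n)) \<longlonglongrightarrow> 0"
    by (rule tendsto_inverse_0_at_top[OF T(1)])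
  have "\<forall>\<^sub>F t in at_top. F (\<lambda>k. w k + t * \<eta> k) j = w j + (t + 1) * \<eta> j" for j
  proof -
    obtain c k where affine: "\<forall>\<^sub>F t in at_top. F (\<lambda>l. w l + t * \<eta> l) j = c + t * \<eta> k"
      using eventually_affine by blast
    \<comment> \<open>The deviation of the discounted argument from the ray at parameter \<open>T n - 1\<close>; the shift by one
      comes from \<open>(1 - 1 / T n) * (T n * \<eta>) = (T n - 1) * \<eta>\<close>.\<close>
    define e where "e n l = (1 - 1 / T n) * x n l - (w l + (T n - 1) * \<eta> l)" for n l
    have e: "(\<lambda>n. e n l) \<longlonglongrightarrow> 0" for l
    proof -
      have "(\<lambda>n. (x n l - T n * \<eta> l) - w l - (x n l - T n * \<eta> l) * inverse (T n))
              \<longlonglongrightarrow> w l - w l - w l * 0"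
        by (intro tendsto_intros lim inv)
      moreover have "(x n l - T n * \<eta> l) - w l - (x n l - T n * \<eta> l) * inverse (T n) = e n l" for n
        using T(2)[of n] by (simp add: e_def field_simps)
      ultimately show ?thesis by simp
    qed
    define E where "E n = (\<Sum>l\<in>UNIV. \<bar>e n l\<bar>)" for n
    have E: "E \<longlonglongrightarrow> 0"
      unfolding E_def using tendsto_sum[of UNIV "\<lambda>l n. \<bar>e n l\<bar>" "\<lambda>_. 0" sequentially]
        tendsto_rabs[OF e] by simp
    have "\<bar>x n j - F (\<lambda>l. w l + (T n - 1) * \<eta> l) j\<bar> \<le> E n" for n
    proof -
      have "\<bar>e n l\<bar> \<le> E n" for l
        unfolding E_def by (rule member_le_sum) auto
      then show ?thesis
        using nonexpansive[of "\<lambda>l. (1 - 1 / T n) * x n l" "\<lambda>l. w l + (T n - 1) * \<eta> l" "E n" j]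
        unfolding e_def fixed by blast
    qed
    then have "(\<lambda>n. x n j - F (\<lambda>l. w l + (T n - 1) * \<eta> l) j) \<longlonglongrightarrow> 0"
      by (intro Lim_null_comparison[OF _ E]) simp
    from tendsto_diff[OF lim[of j] this]
    have "(\<lambda>n. F (\<lambda>l. w l + (T n - 1) * \<eta> l) j - T n * \<eta> j) \<longlonglongrightarrow> w j"
      by simp
    moreover have "filterlim (\<lambda>n. - 1 + T n) at_top sequentially"
      by (rule filterlim_tendsto_add_at_top[OF tendsto_const T(1)])
    from eventually_compose_filterlim[OF affine this]
    have "\<forall>\<^sub>F n in sequentially.
        F (\<lambda>l. w l + (T n - 1) * \<eta> l) j - T n * \<eta> j = (c - \<eta> k) + T n * (\<eta> k - \<eta> j)"
    proof eventually_elim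
      case (elim n)
      moreover have "- 1 + T n = T n - 1" by simp
      ultimately have "F (\<lambda>l. w l + (T n - 1) * \<eta> l) j = c + (T n - 1) * \<eta> k" by metis
      then show ?case by (simp only:) (simp add: algebra_simps)
    qed
    ultimately have "(\<lambda>n. (c - \<eta> k) + T n * (\<eta> k - \<eta> j)) \<longlonglongrightarrow> w j"
      by (simp add: tendsto_cong)
    from affine_limit_unique[OF T(1) this] have "\<eta> k = \<eta> j" "c = w j + \<eta> j"
      by auto
    with affine show ?thesis by (auto simp: algebra_simps)
  qed
  then show thesis by (intro that[of w \<eta>]) (simp add: eventually_all_finite)
qed

lemma escape_rate:
  assumes "\<forall>\<^sub>F t in at_top. \<forall>j. F (\<lambda>k. w k + t * \<eta> k) j = w j + (t + 1) * \<eta> j"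
  shows "(\<lambda>N. (F ^^ N) v j / real N) \<longlonglongrightarrow> \<eta> j"
proof -
  obtain t\<^sub>0 where inv: "\<And>t j. t \<ge> t\<^sub>0 \<Longrightarrow> F (\<lambda>k. w k + t * \<eta> k) j = w j + (t + 1) * \<eta> j"
    using assms unfolding eventually_at_top_linorder by auto
  define z where "z k = w k + t\<^sub>0 * \<eta> k" for k
  have z: "(F ^^ N) z = (\<lambda>k. w k + (t\<^sub>0 + real N) * \<eta> k)" for N
  proof (induction N)
    case (Suc N)
    then show ?case
      by (simp add: inv add.commute add.left_commute)
  qed (simp add: z_def)
  define D where "D = (\<Sum>k\<in>UNIV. \<bar>v k - z k\<bar>)"
  have "\<bar>v k - z k\<bar> \<le> D" for k
    unfolding D_def by (rule member_le_sum) auto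
  then have D: "\<bar>(F ^^ N) v j - (F ^^ N) z j\<bar> \<le> D" for N
    by (rule funpow_nonexpansive)
  have "\<bar>(F ^^ N) v j / real N - \<eta> j\<bar> \<le> (D + \<bar>z j\<bar>) / real N" if "N > 0" for N
  proof -
    have "(F ^^ N) v j / real N - \<eta> j = ((F ^^ N) v j - (F ^^ N) z j + z j) / real N"
      using that by (simp add: z z_def field_simps)
    moreover have "\<bar>(F ^^ N) v j - (F ^^ N) z j + z j\<bar> \<le> D + \<bar>z j\<bar>"
      using D[of N] by linarith
    ultimately show ?thesis by (simp add: divide_right_mono)
  qed
  then have "\<forall>\<^sub>F N in sequentially. norm ((F ^^ N) v j / real N - \<eta> j) \<le> (D + \<bar>z j\<bar>) / real N"
    by (auto intro: eventually_mono[OF eventually_gt_at_top[of 0]])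
  then have "(\<lambda>N. (F ^^ N) v j / real N - \<eta> j) \<longlonglongrightarrow> 0"
    by (rule Lim_null_comparison) (rule lim_const_over_n)
  then show ?thesis by (simp add: LIM_zero_iff)
qed

end


section \<open>The operator of the mean payoff game\<close>

text \<open>
  Germs along the filter that are pairwise comparable form a linear preorder, in which a finite family
  has a least member. The family \<open>h\<close> will be the entries of a minimum or, negated, of a maximum.
\<close>
lemma finite_family_min_eventually:
  fixes h :: "'i \<Rightarrow> 'a \<Rightarrow> 'b::linorder"
  assumes "finite I" "I \<noteq> {}"
    and "\<And>i j. (\<forall>\<^sub>F t in G. h i t \<le> h j t) \<or> (\<forall>\<^sub>F t in G. h j t \<le> h i t)"
  shows "\<exists>i\<in>I. \<forall>\<^sub>F t in G. \<forall>j\<in>I. h i t \<le> h j t"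
  using assms(1,2)
proof (induction I rule: finite_ne_induct)
  case (singleton i)
  show ?case by simp
next
  case (insert i I)
  then obtain i' where i': "i' \<in> I" "\<forall>\<^sub>F t in G. \<forall>j\<in>I. h i' t \<le> h j t" by blast
  from assms(3)[of i i'] show ?case
  proof
    assume "\<forall>\<^sub>F t in G. h i t \<le> h i' t"
    with i'(2) have "\<forall>\<^sub>F t in G. \<forall>j\<in>insert i I. h i t \<le> h j t"
      by eventually_elim (auto intro: order_trans)
    then show ?thesis by blast
  next
    assume "\<forall>\<^sub>F t in G. h i' t \<le> h i t"
    with i'(2) have "\<forall>\<^sub>F t in G. \<forall>j\<in>insert i I. h i' t \<le> h j t"
      by eventually_elim auto
    then show ?thesis using i'(1) by blast
  qed
qed

lemma affine_germs_linear_real: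
  fixes a b a' b' :: real
  shows "(\<forall>\<^sub>F t in at_top. a + t * b \<le> a' + t * b') \<or> (\<forall>\<^sub>F t in at_top. a' + t * b' \<le> a + t * b)"
proof -
  have *: "\<forall>\<^sub>F t in at_top. a + t * b \<le> a' + t * b'" if "b < b'" for a b a' b' :: real
    using eventually_ge_at_top[of "(a - a') / (b' - b)"]
  proof eventually_elim
    case (elim t)
    with that have "a - a' \<le> t * (b' - b)" by (simp add: pos_divide_le_eq)
    then show ?case by (simp add: algebra_simps)
  qed
  show ?thesis
  proof (cases b b' rule: linorder_cases)
    case equal
    then show ?thesis by (cases "a \<le> a'") auto
  qed (simp_all add: *)
qed

lemma real_eq_of_ereal_sum: "ereal r = c + ereal y \<Longrightarrow> r = real_of_ereal c + y"
  by (cases c) auto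

lemma affine_germs_linear:
  fixes c c' :: ereal and a b a' b' :: real
  shows "(\<forall>\<^sub>F t in at_top. c + ereal (a + t * b) \<le> c' + ereal (a' + t * b')) \<or>
    (\<forall>\<^sub>F t in at_top. c' + ereal (a' + t * b') \<le> c + ereal (a + t * b))"
proof (cases c; cases c')
  fix r r' assume "c = ereal r" "c' = ereal r'"
  then show ?thesis
    using affine_germs_linear_real[of "r + a" b "r' + a'" b'] by (simp add: add.assoc)
qed auto

locale payoff_game =
  fixes A B :: "ereal ^ 'n ^ 'm"
  assumes A_not_PInf: "\<And>i j. A $ i $ j \<noteq> \<infinity>" and B_not_PInf: "\<And>i j. B $ i $ j \<noteq> \<infinity>"
    and Min_can_move: "\<And>j. \<exists>i. A $ i $ j \<noteq> -\<infinity>" and Max_can_move: "\<And>i. \<exists>j. B $ i $ j \<noteq> -\<infinity>"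
begin

definition real_dp :: "('n \<Rightarrow> real) \<Rightarrow> 'n \<Rightarrow> real" where
  "real_dp x j = real_of_ereal (dp_operator A B (\<chi> k. ereal (x k)) $ j)"

lemma ereal_real_dp: "ereal (real_dp x j) = dp_operator A B (\<chi> k. ereal (x k)) $ j"
proof -
  have "\<bar>dp_operator A B (\<chi> k. ereal (x k)) $ j\<bar> \<noteq> \<infinity>"
    by (rule dp_operator_finite[OF A_not_PInf B_not_PInf Min_can_move Max_can_move]) simp
  then show ?thesis by (simp add: real_dp_def ereal_real)
qed

lemma dp_operator_funpow: "(dp_operator A B ^^ N) 0 $ j = ereal ((real_dp ^^ N) (\<lambda>_. 0) j)"
proof -
  have "(dp_operator A B ^^ N) 0 = (\<chi> k. ereal ((real_dp ^^ N) (\<lambda>_. 0) k))"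
  proof (induction N)
    case 0
    show ?case by (simp add: vec_eq_iff)
  next
    case (Suc N)
    show ?case by (simp add: Suc.IH) (simp add: vec_eq_iff ereal_real_dp)
  qed
  then show ?thesis by simp
qed

text \<open>
  The form in which the game enters all order arguments: no minimum or maximum is left, and the right-hand
  side is the inequality that defines the tropical polyhedron, with \<open>y\<close> in place of \<open>x\<^sub>j\<close> on the left.
\<close>
lemma le_real_dp_iff:
  "y \<le> real_dp x j \<longleftrightarrow> (\<forall>i. \<exists>k. A $ i $ j + ereal y \<le> B $ i $ k + ereal (x k))"
proof -
  have "y \<le> real_dp x j \<longleftrightarrow> ereal y \<le> dp_operator A B (\<chi> k. ereal (x k)) $ j"
    by (simp flip: ereal_real_dp)
  also have "\<dots> \<longleftrightarrow> (\<forall>i. ereal y \<le> - (A $ i $ j) + (MAX k. B $ i $ k + ereal (x k)))"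
    by (simp add: dp_operator_def)
  also have "\<dots> \<longleftrightarrow> (\<forall>i. A $ i $ j + ereal y \<le> (MAX k. B $ i $ k + ereal (x k)))"
  proof -
    have "ereal y \<le> - a + M \<longleftrightarrow> a + ereal y \<le> M" if "a \<noteq> \<infinity>" for a M
      using that by (cases a; cases M) auto
    then show ?thesis using A_not_PInf by blast
  qed
  also have "\<dots> \<longleftrightarrow> (\<forall>i. \<exists>k. A $ i $ j + ereal y \<le> B $ i $ k + ereal (x k))"
    by (simp add: Max_ge_iff)
  finally show ?thesis .
qed

lemma real_dp_shift_mono:
  assumes "\<And>k. x k \<le> y k + d"
  shows "real_dp x j \<le> real_dp y j + d"
proof -
  have "real_dp x j - d \<le> real_dp y j"
    unfolding le_real_dp_iff
  proof
    fix i
    obtain k where "A $ i $ j + ereal (real_dp x j) \<le> B $ i $ k + ereal (x k)"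
      using le_real_dp_iff[of "real_dp x j" x j] by blast
    then have "A $ i $ j + ereal (real_dp x j - d) \<le> B $ i $ k + ereal (y k)"
      using assms[of k] A_not_PInf[of i j] B_not_PInf[of i k]
      by (cases "A $ i $ j"; cases "B $ i $ k") auto
    then show "\<exists>k. A $ i $ j + ereal (real_dp x j - d) \<le> B $ i $ k + ereal (y k)" ..
  qed
  then show ?thesis by simp
qed

lemma real_dp_as_Min_Max:
  "ereal (real_dp x j) = (MIN i. MAX k. - (A $ i $ j) + B $ i $ k + ereal (x k))"
proof -
  have "- a + (MAX k. h k) = (MAX k. - a + h k)" for a :: ereal and h :: "'n \<Rightarrow> ereal"
    by (subst mono_Max_commute) (auto simp: mono_def add_left_mono image_image)
  then show ?thesis
    by (simp add: ereal_real_dp dp_operator_def add.assoc)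
qed

lemma real_dp_choice:
  "\<exists>i k. real_dp x j = real_of_ereal (- (A $ i $ j) + B $ i $ k) + x k"
proof -
  have "ereal (real_dp x j) \<in> range (\<lambda>i. MAX k. - (A $ i $ j) + B $ i $ k + ereal (x k))"
    unfolding real_dp_as_Min_Max by (rule Min_in) auto
  then obtain i where i: "ereal (real_dp x j) = (MAX k. - (A $ i $ j) + B $ i $ k + ereal (x k))"
    by blast
  moreover have "\<dots> \<in> range (\<lambda>k. - (A $ i $ j) + B $ i $ k + ereal (x k))"
    by (rule Max_in) auto
  ultimately obtain k where "ereal (real_dp x j) = - (A $ i $ j) + B $ i $ k + ereal (x k)"
    by (metis (no_types, lifting) imageE)
  then show ?thesis using real_eq_of_ereal_sum by blast
qed

text \<open>
  For large \<open>t\<close> Max has a constant best reply \<open>\<tau> i\<close> in each state \<open>i\<close>, and against these replies Min has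
  a constant best move.
\<close>
lemma real_dp_eventually_affine:
  "\<exists>c k. \<forall>\<^sub>F t in at_top. real_dp (\<lambda>l. w l + t * \<eta> l) j = c + t * \<eta> k"
proof -
  define h where "h i k t = - (A $ i $ j) + B $ i $ k + ereal (w k + t * \<eta> k)" for i k t
  have "\<exists>k. \<forall>\<^sub>F t in at_top. (MAX l. h i l t) = h i k t" for i
  proof -
    have "\<exists>k\<in>UNIV. \<forall>\<^sub>F t in at_top. \<forall>l\<in>UNIV. - h i k t \<le> - h i l t"
      by (rule finite_family_min_eventually)
        (use affine_germs_linear in \<open>auto simp: h_def\<close>)
    then show ?thesis
      by (auto elim!: eventually_mono intro!: Max_eqI)
  qed
  then obtain \<tau> where \<tau>: "\<And>i. \<forall>\<^sub>F t in at_top. (MAX l. h i l t) = h i (\<tau> i) t" by metis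
  have "\<exists>i\<in>UNIV. \<forall>\<^sub>F t in at_top. \<forall>i'\<in>UNIV. h i (\<tau> i) t \<le> h i' (\<tau> i') t"
    by (rule finite_family_min_eventually) (use affine_germs_linear in \<open>auto simp: h_def\<close>)
  then obtain i where i: "\<forall>\<^sub>F t in at_top. \<forall>i'. h i (\<tau> i) t \<le> h i' (\<tau> i') t" by auto
  have "\<forall>\<^sub>F t in at_top. \<forall>i. (MAX l. h i l t) = h i (\<tau> i) t"
    by (simp add: eventually_all_finite \<tau>)
  with i have "\<forall>\<^sub>F t in at_top. real_dp (\<lambda>l. w l + t * \<eta> l) j
      = (real_of_ereal (- (A $ i $ j) + B $ i $ \<tau> i) + w (\<tau> i)) + t * \<eta> (\<tau> i)"
  proof eventually_elim
    case (elim t)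
    have "ereal (real_dp (\<lambda>l. w l + t * \<eta> l) j) = (MIN i. h i (\<tau> i) t)"
      using elim(2) by (simp add: real_dp_as_Min_Max flip: h_def)
    also have "\<dots> = h i (\<tau> i) t"
      using elim(1) by (auto intro!: Min_eqI)
    finally show ?case
      unfolding h_def by (auto dest: real_eq_of_ereal_sum)
  qed
  then show ?thesis by blast
qed

sublocale choice_operator real_dp "range (\<lambda>(i, j, k). (real_of_ereal (- (A $ i $ j) + B $ i $ k), k))"
proof
  show "\<exists>(c, k) \<in> range (\<lambda>(i, j, k). (real_of_ereal (- (A $ i $ j) + B $ i $ k), k)).
      real_dp x j = c + x k" for x j
    using real_dp_choice[of x j] by fastforce
qed (auto intro: real_dp_shift_mono real_dp_eventually_affine)

section \<open>The support of the tropical polyhedron\<close>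

lemma mem_tropical_polyhedron_iff:
  "x \<in> tropical_polyhedron A B \<longleftrightarrow>
    (\<forall>j. x $ j \<noteq> \<infinity>) \<and> (\<forall>i j. \<exists>k. A $ i $ j + x $ j \<le> B $ i $ k + x $ k)"
  by (simp add: tropical_polyhedron_def del: Max_ge_iff) (simp add: Max_ge_iff)

text \<open>
  The iterates stay above \<open>x\<close> by monotonicity. The start vector is \<open>x\<close> with every $-\infty$ raised to
  \<open>0\<close>, the value of \<^const>\<open>real_of_ereal\<close> there.
\<close>
lemma polyhedron_le_funpow:
  assumes x: "x \<in> tropical_polyhedron A B"
  shows "x $ j \<le> ereal ((real_dp ^^ N) (\<lambda>k. real_of_ereal (x $ k)) j)"
proof (induction N arbitrary: j)
  case 0
  show ?case using x by (cases "x $ j") (auto simp: mem_tropical_polyhedron_iff)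
next
  case (Suc N)
  show ?case
  proof (cases "x $ j")
    case (real y)
    have "y \<le> real_dp ((real_dp ^^ N) (\<lambda>k. real_of_ereal (x $ k))) j"
      unfolding le_real_dp_iff
    proof
      fix i
      obtain k where "A $ i $ j + x $ j \<le> B $ i $ k + x $ k"
        using x unfolding mem_tropical_polyhedron_iff by blast
      also have "\<dots> \<le> B $ i $ k + ereal ((real_dp ^^ N) (\<lambda>k. real_of_ereal (x $ k)) k)"
        by (rule add_left_mono[OF Suc.IH])
      finally show "\<exists>k. A $ i $ j + ereal y \<le> B $ i $ k + ereal ((real_dp ^^ N) (\<lambda>k. real_of_ereal (x $ k)) k)"
        unfolding real ..
    qed
    with real show ?thesis by simp
  qed (use x in \<open>auto simp: mem_tropical_polyhedron_iff\<close>)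
qed

lemma support_imp_nonneg_rate:
  assumes x: "x \<in> tropical_polyhedron A B" "x $ j \<noteq> -\<infinity>"
    and lim: "\<And>v. (\<lambda>N. (real_dp ^^ N) v j / real N) \<longlonglongrightarrow> \<rho>"
  shows "\<rho> \<ge> 0"
proof -
  obtain y where y: "x $ j = ereal y"
    using x by (cases "x $ j") (auto simp: mem_tropical_polyhedron_iff)
  have "y / real N \<le> (real_dp ^^ N) (\<lambda>k. real_of_ereal (x $ k)) j / real N" for N
    using polyhedron_le_funpow[OF x(1), of j N] y by (simp add: divide_right_mono)
  then show ?thesis
    by (intro LIMSEQ_le[OF lim_const_over_n[of y] lim]) blast
qed

text \<open>
  The witness is a point far out on the half-line, with the coordinates of negative rate cut off. For
  large \<open>t\<close> the slope decides every comparison between different rates, so a coordinate \<open>k\<close> that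
  dominates \<open>j\<close> has \<open>\<eta> k \<ge> \<eta> j\<close> and survives the cut whenever \<open>j\<close> does.
\<close>
lemma nonneg_rates_are_support:
  assumes half_line: "\<forall>\<^sub>F t in at_top. \<forall>j. real_dp (\<lambda>k. w k + t * \<eta> k) j = w j + (t + 1) * \<eta> j"
  shows "\<exists>u \<in> tropical_polyhedron A B. vec_support u = {j. \<eta> j \<ge> 0}"
proof -
  have worse: "\<forall>\<^sub>F t in at_top. A $ i $ j \<noteq> -\<infinity> \<longrightarrow> \<eta> k < \<eta> j \<longrightarrow>
      \<not> A $ i $ j + ereal (w j + (t + 1) * \<eta> j) \<le> B $ i $ k + ereal (w k + t * \<eta> k)" for i j k
  proof (cases "A $ i $ j"; cases "B $ i $ k")
    fix a b assume ab: "A $ i $ j = ereal a" "B $ i $ k = ereal b"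
    show ?thesis
      using eventually_gt_at_top[of "(b + w k - a - w j - \<eta> j) / (\<eta> j - \<eta> k)"]
      by eventually_elim (auto simp: ab pos_divide_less_eq algebra_simps)
  qed (use A_not_PInf B_not_PInf in auto)
  then have "\<forall>\<^sub>F t in at_top. \<forall>i j k. A $ i $ j \<noteq> -\<infinity> \<longrightarrow> \<eta> k < \<eta> j \<longrightarrow>
      \<not> A $ i $ j + ereal (w j + (t + 1) * \<eta> j) \<le> B $ i $ k + ereal (w k + t * \<eta> k)"
    by (simp add: eventually_all_finite)
  from eventually_happens'[OF trivial_limit_at_top_linorder eventually_conj[OF this half_line]]
  obtain t where t_worse: "\<forall>i j k. A $ i $ j \<noteq> -\<infinity> \<longrightarrow> \<eta> k < \<eta> j \<longrightarrow>
      \<not> A $ i $ j + ereal (w j + (t + 1) * \<eta> j) \<le> B $ i $ k + ereal (w k + t * \<eta> k)"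
    and t_inv: "\<forall>j. real_dp (\<lambda>k. w k + t * \<eta> k) j = w j + (t + 1) * \<eta> j"
    by (elim exE conjE) (rule that)
  define u where "u = (\<chi> j. if \<eta> j \<ge> 0 then ereal (w j + t * \<eta> j) else -\<infinity>)"
  have "\<exists>k. A $ i $ j + u $ j \<le> B $ i $ k + u $ k" for i j
  proof (cases "A $ i $ j = -\<infinity> \<or> \<eta> j < 0")
    case True
    then have "A $ i $ j + u $ j = -\<infinity>"
      using A_not_PInf[of i j] by (cases "A $ i $ j") (auto simp: u_def)
    then show ?thesis by (metis ereal_less_eq(2))
  next
    case False
    obtain k where k: "A $ i $ j + ereal (w j + (t + 1) * \<eta> j) \<le> B $ i $ k + ereal (w k + t * \<eta> k)"
      using le_real_dp_iff[of "w j + (t + 1) * \<eta> j" "\<lambda>k. w k + t * \<eta> k" j] t_inv by auto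
    then have "\<eta> j \<le> \<eta> k" using False t_worse by (meson not_less)
    \<comment> \<open>Since \<open>\<eta> j \<ge> 0\<close>, the half-line does not decrease in coordinate \<open>j\<close> from \<open>t\<close> to \<open>t + 1\<close>.\<close>
    have "A $ i $ j + u $ j \<le> A $ i $ j + ereal (w j + (t + 1) * \<eta> j)"
      using False by (intro add_left_mono) (auto simp: u_def algebra_simps)
    also note k
    also have "B $ i $ k + ereal (w k + t * \<eta> k) = B $ i $ k + u $ k"
      using False \<open>\<eta> j \<le> \<eta> k\<close> by (simp add: u_def)
    finally show ?thesis ..
  qed
  then have "u \<in> tropical_polyhedron A B"
    by (auto simp: mem_tropical_polyhedron_iff u_def)
  moreover have "vec_support u = {j. \<eta> j \<ge> 0}"
    by (auto simp: vec_support_def u_def)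
  ultimately show ?thesis by blast
qed

lemma mean_payoff_eqI:
  assumes "\<And>j. (\<lambda>N. (real_dp ^^ N) (\<lambda>_. 0) j / real N) \<longlonglongrightarrow> \<eta> j"
  shows "mean_payoff (dp_operator A B) = (\<chi> j. \<eta> j)"
  unfolding mean_payoff_def
  by (rule limI, rule vec_tendstoI) (simp add: dp_operator_funpow assms)

end

theorem theorem3p2:
  fixes A B :: "ereal ^ 'n ^ 'm"
  assumes "\<And>i j. A $ i $ j \<noteq> \<infinity>" and "\<And>i j. B $ i $ j \<noteq> \<infinity>"
    and "\<And>j. \<exists>i. A $ i $ j \<noteq> -\<infinity>" and "\<And>i. \<exists>j. B $ i $ j \<noteq> -\<infinity>"
  shows "(\<exists>u \<in> tropical_polyhedron A B. polyhedron_support A B = vec_support u) \<and>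
    polyhedron_support A B = {j. mean_payoff (dp_operator A B) $ j \<ge> 0}"
proof -
  interpret payoff_game A B
    using assms by unfold_locales
  obtain w \<eta> where half_line:
    "\<forall>\<^sub>F t in at_top. \<forall>j. real_dp (\<lambda>k. w k + t * \<eta> k) j = w j + (t + 1) * \<eta> j"
    by (rule invariant_half_line)
  note rate = escape_rate[OF half_line]
  have \<chi>: "mean_payoff (dp_operator A B) $ j = \<eta> j" for j
    using mean_payoff_eqI[OF rate] by simp
  obtain u where u: "u \<in> tropical_polyhedron A B" "vec_support u = {j. \<eta> j \<ge> 0}"
    using nonneg_rates_are_support[OF half_line] by blast
  have "polyhedron_support A B \<subseteq> {j. \<eta> j \<ge> 0}"
    using support_imp_nonneg_rate[OF _ _ rate]
    by (auto simp: polyhedron_support_def vec_support_def)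
  moreover have "vec_support u \<subseteq> polyhedron_support A B"
    using u(1) by (auto simp: polyhedron_support_def)
  ultimately show ?thesis using u \<chi> by auto
qed

end
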